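(* For any thresholds $\varepsilon_1>\varepsilon_2>\ldots>\varepsilon_{\ell_{\max}}>0$, the iterative refinement algorithm described in the context, run with these thresholds as input, returns after a finite number $m\in\mathbb{N}$ of iterations a discretization $(h^{(m)},t^{(m)},\rho^{(m)})$ with \[E(h^{(m)},t^{(m)},\rho^{(m)})\le\varepsilon_{\ell_{\max}}.\]
   Context: Setting. $\mathbb{R}^d$ carries the max norm $\|\cdot\|_\infty$; $B_r(x)$ is the closed ball of radius $r$ in this norm; $\mathcal{K}(\mathbb{R}^d)$ and $\mathcal{KC}(\mathbb{R}^d)$ are the nonempty compact, respectively nonempty compact convex, subsets of $\mathbb{R}^d$; $\mathrm{dist}_H$ is the Hausdorff distance. When delimiting indices, $[m,n]=\{m,m+1,\ldots,n\}$. Let $T>0$, $X_0\in\mathcal{K}(\mathbb{R}^d)$, and let $F:\mathbb{R}^d\to\mathcal{KC}(\mathbb{R}^d)$ satisfy $\mathrm{dist}_H(F(x),F(y))\le L\|x-y\|_\infty$ for all $x,y\in\mathbb{R}^d$ and $\sup_{x\in\mathbb{R}^d}\sup_{f\in F(x)}\|f\|_\infty\le P$, with constants $L,P>0$. For $t\in[0,T]$, let $R^F(t)$ be the set of all values $x(t)$, where $x(\cdot)$ ranges over all $x(\cdot)\in W^{1,1}([0,T],\mathbb{R}^d)$ with $\dot x(s)\in F(x(s))$ for a.e. $s\in(0,T)$ and $x(0)\in X_0$. Put $d_R:=\max_{t\in[0,T]}\dim R^F(t)$ and $d_F:=\max_{t\in[0,T]}\max_{x\in R^F(t)}\dim F(x)$,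 where $\dim$ denotes the dimension of a set. These two numbers enter only as exponents. Discretizations. A discretization is $(h,t,\rho)\in\mathbb{R}^n_{>0}\times\mathbb{R}^{n+1}_{+}\times\mathbb{R}^{n+1}_{>0}$, $n\ge 1$, with $h=(h_1,\ldots,h_n)$, $\sum_j h_j=T$, $t=(t_0,\ldots,t_n)$, $t_k=\sum_{j=1}^k h_j$, $\rho=(\rho_0,\ldots,\rho_n)$ (here $\mathbb{R}_+$ and $\mathbb{R}_{>0}$ indicate nonnegative and positive components). For $r>0$ and $A\in\mathcal{K}(\mathbb{R}^d)$ let $\pi_r(A):=(A+B_{r/2}(0))\cap r\mathbb{Z}^d$. The discrete reachable sets are $R^F_{h,\rho}(0)=\pi_{\rho_0}(X_0)$ and $R^F_{h,\rho}(k)=\bigcup_{x\in R^F_{h,\rho}(k-1)}\pi_{\rho_k}(x+h_kF(x))$ for $k\in[1,n]$. Error bound. $E(h,t,\rho):=\sum_{j=0}^n\mathcal{E}_j(h,t,\rho)$ with $\mathcal{E}_0:=e^{LT}\frac{\rho_0}{2}$ and $\mathcal{E}_j:=e^{L(T-t_j)}(e^{Lh_j}-1)\left(Ph_j+\frac{\rho_j}{2}+\frac{\rho_j}{2Lh_j}\right)$ for $j\in[1,n]$. Cost estimator. For $v_R,v_F:[0,T]\to\mathbb{R}_{>0}$, $C(h,t,\rho;v_R,v_F):=\sum_{j=0}^{n-1}\frac{v_R(t_j)}{\rho_j^{d_R}}\,\frac{v_F(t_j)h_{j+1}^{d_F}}{\rho_{j+1}^{d_F}}$. Refinement rule. $\psi[h,t,\rho;0]:=(h,t,(\rho_0/4,\rho_1,\ldots,\rho_n))$,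 and for $j\in[1,n]$, $\psi[h,t,\rho;j]:=(h',t',\rho')$ with $h'=(h_1,\ldots,h_{j-1},h_j/2,h_j/2,h_{j+1},\ldots,h_n)$, $t'=(t_0,\ldots,t_{j-1},t_j-h_j/2,t_j,t_{j+1},\ldots,t_n)$, $\rho'=(\rho_0,\ldots,\rho_{j-1},\rho_j/4,\rho_j/4,\rho_{j+1},\ldots,\rho_n)$. Put $\Delta E(h,t,\rho;j):=E(\psi[h,t,\rho;j])-E(h,t,\rho)$ and $\Delta C(h,t,\rho,v_R,v_F;j):=C(\psi[h,t,\rho;j];v_R,v_F)-C(h,t,\rho;v_R,v_F)$. Algorithm. Input: $\varepsilon_1>\ldots>\varepsilon_{\ell_{\max}}>0$. Initialize $h^{(0)}=(T)$, $t^{(0)}=(0,T)$, $\rho^{(0)}=(2LPT^2,2LPT^2)$, $n_0=1$, $m=0$, $\ell=0$. While $\ell\le\ell_{\max}$: (a) If $\ell=0$ or $E(h^{(m)},t^{(m)},\rho^{(m)})\le\varepsilon_\ell$: compute the sets $R_k:=R^F_{h^{(m)},\rho^{(m)}}(k)$, $k\in[0,n_m]$, and $\hat v_{R,j}:=(\#R_j)(\rho_j^{(m)})^{d_R}$ for $j\in[0,n_m]$, $\hat v_{F,j}:=\frac{1}{\#R_j}\Big(\sum_{x\in R_j}\#\pi_{\rho^{(m)}_{j+1}}(x+h^{(m)}_{j+1}F(x))\Big)\big(\rho^{(m)}_{j+1}/h^{(m)}_{j+1}\big)^{d_F}$ for $j\in[0,n_m-1]$, and $\hat v_{F,n_m}:=\hat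 v_{F,n_m-1}$, where $\#$ denotes cardinality. Let $v_R^{(m)},v_F^{(m)}:[0,T]\to\mathbb{R}_{>0}$ be the piecewise linear interpolants of $(t_j^{(m)},\hat v_{R,j})_{j=0}^{n_m}$ and $(t_j^{(m)},\hat v_{F,j})_{j=0}^{n_m}$. Set $\ell\leftarrow\ell+1$. (b) Otherwise: let $k_m$ be an index maximizing $\frac{-\Delta E(h^{(m)},t^{(m)},\rho^{(m)};j)}{\Delta C(h^{(m)},t^{(m)},\rho^{(m)},v_R^{(m)},v_F^{(m)};j)}$ over $j\in[0,n_m]$; set $n_{m+1}=n_m$ if $k_m=0$ and $n_{m+1}=n_m+1$ otherwise; set $(h^{(m+1)},t^{(m+1)},\rho^{(m+1)})=\psi[h^{(m)},t^{(m)},\rho^{(m)};k_m]$ and $(v_R^{(m+1)},v_F^{(m+1)})=(v_R^{(m)},v_F^{(m)})$; set $m\leftarrow m+1$. When the loop ends, return $(h^{(m)},t^{(m)},\rho^{(m)})$ and the sets $R^F_{h^{(m)},\rho^{(m)}}(k)$, $k\in[0,n_m]$.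
   Formalization: Assumes d_R > 0 or that the initial discretization already has E at most the last threshold: if d_R = 0 the cost does not depend on ρ_0, so ΔC for index 0 is zero and the quotient maximized in step (b) is undefined. *)

theory Defs
  imports "HOL-Analysis.Analysis"
begin

section \<open>Sets in the max norm\<close>

text \<open>The max norm on \<^typ>\<open>real ^ 'n\<close> is \<^const>\<open>infnorm\<close>.\<close>

definition max_ball :: "real ^ 'n \<Rightarrow> real \<Rightarrow> (real ^ 'n) set" where
  "max_ball x r = {y. infnorm (y - x) \<le> r}"

definition hausdorff_dist :: "(real ^ 'n) set \<Rightarrow> (real ^ 'n) set \<Rightarrow> real" where
  "hausdorff_dist A B =
     max (SUP a\<in>A. INF b\<in>B. infnorm (a - b)) (SUP b\<in>B. INF a\<in>A. infnorm (a - b))"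

definition grid :: "real \<Rightarrow> (real ^ 'n) set" where
  "grid r = {r *\<^sub>R z | z. \<forall>i. z $ i \<in> \<int>}"

definition grid_proj :: "real \<Rightarrow> (real ^ 'n) set \<Rightarrow> (real ^ 'n) set" where
  "grid_proj r A = {a + b | a b. a \<in> A \<and> b \<in> max_ball 0 (r / 2)} \<inter> grid r"


section \<open>Solutions and reachable sets of the differential inclusion\<close>

definition test_function :: "real \<Rightarrow> (real \<Rightarrow> real) \<Rightarrow> bool" where
  "test_function T \<phi> \<longleftrightarrow>
     (\<forall>k s. ((deriv ^^ k) \<phi>) field_differentiable (at s)) \<and>
     (\<exists>a b. 0 < a \<and> b < T \<and> (\<forall>s. s \<notin> {a..b} \<longrightarrow> \<phi> s = 0))"

definition weak_derivative :: "real \<Rightarrow> (real \<Rightarrow> real ^ 'n) \<Rightarrow> (real \<Rightarrow> real ^ 'n) \<Rightarrow> bool" where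
  "weak_derivative T x g \<longleftrightarrow>
     (\<forall>\<phi>. test_function T \<phi> \<longrightarrow>
        integral {0..T} (\<lambda>s. deriv \<phi> s *\<^sub>R x s) = - integral {0..T} (\<lambda>s. \<phi> s *\<^sub>R g s))"

text \<open>An element of the Sobolev space \<open>W\<^sup>1\<^sup>,\<^sup>1([0,T])\<close> is represented by its unique continuous
  representative, so that the point values \<open>x 0\<close> and \<open>x t\<close> make sense.\<close>

definition is_solution ::
    "real \<Rightarrow> (real ^ 'n) set \<Rightarrow> (real ^ 'n \<Rightarrow> (real ^ 'n) set) \<Rightarrow> (real \<Rightarrow> real ^ 'n) \<Rightarrow> bool" where
  "is_solution T X0 F x \<longleftrightarrow>
     continuous_on {0..T} x \<and> x 0 \<in> X0 \<and>
     (\<exists>g. g absolutely_integrable_on {0..T} \<and> weak_derivative T x g \<and>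
          (AE s in lebesgue. s \<in> {0<..<T} \<longrightarrow> g s \<in> F (x s)))"

definition reach ::
    "real \<Rightarrow> (real ^ 'n) set \<Rightarrow> (real ^ 'n \<Rightarrow> (real ^ 'n) set) \<Rightarrow> real \<Rightarrow> (real ^ 'n) set" where
  "reach T X0 F t = {x t | x. is_solution T X0 F x}"

text \<open>Reachable sets need not be convex, so the dimension may be the affine, Hausdorff, packing,
  box-counting or covering dimension. All of these are monotone and agree with the affine
  dimension on nonempty convex sets, and this is the only requirement made here.\<close>

definition set_dimension :: "((real ^ 'n) set \<Rightarrow> ennreal) \<Rightarrow> bool" where
  "set_dimension dm \<longleftrightarrow>
     (\<forall>A B. A \<subseteq> B \<longrightarrow> dm A \<le> dm B) \<and>
     (\<forall>A. convex A \<and> A \<noteq> {} \<longrightarrow> dm A = ennreal (of_int (aff_dim A)))"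

lemma set_dimension_aff_dim: "set_dimension (\<lambda>A. ennreal (of_int (aff_dim A)))"
  by (auto simp: set_dimension_def intro!: ennreal_leI aff_dim_subset)

definition reach_dim ::
    "((real ^ 'n) set \<Rightarrow> ennreal) \<Rightarrow> real \<Rightarrow> (real ^ 'n) set \<Rightarrow> (real ^ 'n \<Rightarrow> (real ^ 'n) set) \<Rightarrow> real" where
  "reach_dim dm T X0 F = enn2real (SUP t\<in>{0..T}. dm (reach T X0 F t))"

definition field_dim ::
    "((real ^ 'n) set \<Rightarrow> ennreal) \<Rightarrow> real \<Rightarrow> (real ^ 'n) set \<Rightarrow> (real ^ 'n \<Rightarrow> (real ^ 'n) set) \<Rightarrow> real" where
  "field_dim dm T X0 F = enn2real (SUP t\<in>{0..T}. SUP x\<in>reach T X0 F t. dm (F x))"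


section \<open>Discretizations\<close>

text \<open>Finite vectors are functions on \<^typ>\<open>nat\<close>: \<open>step_of\<close> is relevant on \<open>{1..size_of}\<close>, while
  \<open>time_of\<close> and \<open>mesh_of\<close> are relevant on \<open>{0..size_of}\<close>.\<close>

record discretization =
  size_of :: nat
  step_of :: "nat \<Rightarrow> real"
  time_of :: "nat \<Rightarrow> real"
  mesh_of :: "nat \<Rightarrow> real"

definition is_discretization :: "real \<Rightarrow> discretization \<Rightarrow> bool" where
  "is_discretization T D \<longleftrightarrow>
     1 \<le> size_of D \<and>
     (\<forall>j\<in>{1..size_of D}. 0 < step_of D j) \<and>
     (\<Sum>j=1..size_of D. step_of D j) = T \<and>
     (\<forall>k\<in>{0..size_of D}. time_of D k = (\<Sum>j=1..k. step_of D j)) \<and>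
     (\<forall>k\<in>{0..size_of D}. 0 < mesh_of D k)"

fun discrete_reach ::
    "(real ^ 'n) set \<Rightarrow> (real ^ 'n \<Rightarrow> (real ^ 'n) set) \<Rightarrow> discretization \<Rightarrow> nat \<Rightarrow> (real ^ 'n) set" where
  "discrete_reach X0 F D 0 = grid_proj (mesh_of D 0) X0"
| "discrete_reach X0 F D (Suc k) =
     (\<Union>x\<in>discrete_reach X0 F D k.
        grid_proj (mesh_of D (Suc k)) ((\<lambda>f. x + step_of D (Suc k) *\<^sub>R f) ` F x))"

definition err_term :: "real \<Rightarrow> real \<Rightarrow> real \<Rightarrow> discretization \<Rightarrow> nat \<Rightarrow> real" where
  "err_term L P T D j =
     (if j = 0 then exp (L * T) * (mesh_of D 0 / 2)
      else exp (L * (T - time_of D j)) * (exp (L * step_of D j) - 1) *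
           (P * step_of D j + mesh_of D j / 2 + mesh_of D j / (2 * L * step_of D j)))"

definition err :: "real \<Rightarrow> real \<Rightarrow> real \<Rightarrow> discretization \<Rightarrow> real" where
  "err L P T D = (\<Sum>j=0..size_of D. err_term L P T D j)"

definition cost ::
    "real \<Rightarrow> real \<Rightarrow> (real \<Rightarrow> real) \<Rightarrow> (real \<Rightarrow> real) \<Rightarrow> discretization \<Rightarrow> real" where
  "cost dR dF vR vF D =
     (\<Sum>j=0..<size_of D.
        vR (time_of D j) / mesh_of D j powr dR *
        (vF (time_of D j) * step_of D (Suc j) powr dF / mesh_of D (Suc j) powr dF))"

definition refine :: "discretization \<Rightarrow> nat \<Rightarrow> discretization" where
  "refine D j =
     (if j = 0 then D\<lparr>mesh_of := (mesh_of D)(0 := mesh_of D 0 / 4)\<rparr>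
      else \<lparr>size_of = Suc (size_of D),
            step_of = (\<lambda>i. if i < j then step_of D i
                           else if i \<le> Suc j then step_of D j / 2
                           else step_of D (i - 1)),
            time_of = (\<lambda>i. if i < j then time_of D i
                           else if i = j then time_of D j - step_of D j / 2
                           else time_of D (i - 1)),
            mesh_of = (\<lambda>i. if i < j then mesh_of D i
                           else if i \<le> Suc j then mesh_of D j / 4
                           else mesh_of D (i - 1))\<rparr>)"

definition delta_err :: "real \<Rightarrow> real \<Rightarrow> real \<Rightarrow> discretization \<Rightarrow> nat \<Rightarrow> real" where
  "delta_err L P T D j = err L P T (refine D j) - err L P T D"

definition delta_cost ::
    "real \<Rightarrow> real \<Rightarrow> (real \<Rightarrow> real) \<Rightarrow> (real \<Rightarrow> real) \<Rightarrow> discretization \<Rightarrow> nat \<Rightarrow> real" where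
  "delta_cost dR dF vR vF D j = cost dR dF vR vF (refine D j) - cost dR dF vR vF D"


section \<open>The refinement algorithm\<close>

definition reach_volume ::
    "real \<Rightarrow> (real ^ 'n) set \<Rightarrow> (real ^ 'n \<Rightarrow> (real ^ 'n) set) \<Rightarrow> discretization \<Rightarrow> nat \<Rightarrow> real" where
  "reach_volume dR X0 F D j = real (card (discrete_reach X0 F D j)) * mesh_of D j powr dR"

definition field_volume ::
    "real \<Rightarrow> (real ^ 'n) set \<Rightarrow> (real ^ 'n \<Rightarrow> (real ^ 'n) set) \<Rightarrow> discretization \<Rightarrow> nat \<Rightarrow> real" where
  "field_volume dF X0 F D j =
     (let i = (if j < size_of D then j else size_of D - 1) in
        1 / real (card (discrete_reach X0 F D i)) *
        (\<Sum>x\<in>discrete_reach X0 F D i.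
           real (card (grid_proj (mesh_of D (Suc i)) ((\<lambda>f. x + step_of D (Suc i) *\<^sub>R f) ` F x)))) *
        (mesh_of D (Suc i) / step_of D (Suc i)) powr dF)"

text \<open>The piecewise linear interpolant of the data \<open>(time_of D j, v j)\<close>, \<open>j \<le> size_of D\<close>. Only its
  values on the interval \<open>{0..T}\<close> are meaningful.\<close>

definition interpolant :: "discretization \<Rightarrow> (nat \<Rightarrow> real) \<Rightarrow> real \<Rightarrow> real" where
  "interpolant D v s =
     (let j = (LEAST j. s \<le> time_of D (Suc j)) in
        v j + (s - time_of D j) / (time_of D (Suc j) - time_of D j) * (v (Suc j) - v j))"

record state =
  disc :: discretization
  vR :: "real \<Rightarrow> real"
  vF :: "real \<Rightarrow> real"
  level :: nat
  counter :: nat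

text \<open>The initial values of \<open>vR\<close> and \<open>vF\<close> are irrelevant: the first pass through the loop is made
  with \<open>level = 0\<close> and overwrites them.\<close>

definition initial_state :: "real \<Rightarrow> real \<Rightarrow> real \<Rightarrow> state" where
  "initial_state L P T =
     \<lparr>disc = \<lparr>size_of = 1, step_of = (\<lambda>_. T), time_of = (\<lambda>k. if k = 0 then 0 else T),
              mesh_of = (\<lambda>_. 2 * L * P * T\<^sup>2)\<rparr>,
      vR = undefined, vF = undefined, level = 0, counter = 0\<rparr>"

text \<open>One pass through the loop. It is a relation because any maximizer may be selected in \<open>refine\<close>;
  no pass is possible once \<open>lmax < level\<close>, that is, when the algorithm returns.

  If \<open>dR > 0\<close>, then all the cost differences are positive. If \<open>dR = 0\<close>, then the cost does not depend
  on \<open>mesh_of D 0\<close>, so the quotient for the index \<open>0\<close> has denominator zero and is not defined.\<close>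

inductive loop_pass ::
    "real \<Rightarrow> real \<Rightarrow> real \<Rightarrow> (real ^ 'n) set \<Rightarrow> (real ^ 'n \<Rightarrow> (real ^ 'n) set) \<Rightarrow>
     real \<Rightarrow> real \<Rightarrow> nat \<Rightarrow> (nat \<Rightarrow> real) \<Rightarrow> state \<Rightarrow> state \<Rightarrow> bool"
  for L P T X0 F dR dF lmax \<epsilon> where
  estimate:
    "loop_pass L P T X0 F dR dF lmax \<epsilon> s
       (s\<lparr>vR := interpolant (disc s) (reach_volume dR X0 F (disc s)),
          vF := interpolant (disc s) (field_volume dF X0 F (disc s)),
          level := Suc (level s)\<rparr>)"
  if "level s \<le> lmax" and "level s = 0 \<or> err L P T (disc s) \<le> \<epsilon> (level s)"
| refine:
    "loop_pass L P T X0 F dR dF lmax \<epsilon> s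
       (s\<lparr>disc := refine (disc s) k, counter := Suc (counter s)\<rparr>)"
  if "level s \<le> lmax" and "\<not> (level s = 0 \<or> err L P T (disc s) \<le> \<epsilon> (level s))"
     and "is_arg_max
            (\<lambda>j. - delta_err L P T (disc s) j / delta_cost dR dF (vR s) (vF s) (disc s) j)
            (\<lambda>j. j \<in> {0..size_of (disc s)}) k"

end

(*
  Fix the estimators vR, vF and let Phi be the cost plus the sum of the weights
  rho_j^(-dR) (h_j / rho_j)^dF. Every refinement raises Phi by at least a fixed positive amount,
  so an infinite run of refinements is impossible once Phi is bounded along it.
  The increments of the cost over all indices sum up to at most a constant times Phi, whereas
  refining j removes at least half of the j-th error term, so the error decrements sum up to at
  least E / 2. Hence the maximal quotient is at least a constant times E / Phi, and while E >= eps
  the step taken satisfies Delta Phi <= A * Phi * (-Delta E). So Phi * exp (A * E) does not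
  increase, which bounds Phi. The weights have to be added because the new summand of the cost
  at the midpoint of a halved interval is not controlled by the old summands.
*)

theory Submission
  imports Defs
begin

section \<open>Refinement of a discretization\<close>

text \<open>Halving interval \<open>j\<close> splits summand \<open>j\<close> in two and shifts the
  later ones by one. Summand \<open>Suc (Suc j)\<close> has its own correction, because a cost term
  also depends on the mesh at the preceding index and so changes together with its
  predecessor.\<close>

lemma sum_insert_index:
  fixes f g :: "nat \<Rightarrow> 'a::ab_group_add"
  assumes j: "1 \<le> j" "j \<le> n"
    and before: "\<And>i. i < j \<Longrightarrow> g i = f i"
    and after: "\<And>i. Suc j < i \<Longrightarrow> i \<le> n \<Longrightarrow> g (Suc i) = f i"
  shows "(\<Sum>i=1..Suc n. g i) =
    (\<Sum>i=1..n. f i) + (g j - f j) + g (Suc j) + (if j < n then g (Suc (Suc j)) - f (Suc j) else 0)"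
  using j(2) after
proof (induction n rule: dec_induct)
  case base
  obtain k where k: "j = Suc k"
    using j(1) by (cases j) auto
  have "(\<Sum>i=1..k. g i) = (\<Sum>i=1..k. f i)"
    using before k by (intro sum.cong) auto
  then show ?case
    by (simp add: k)
next
  case (step n)
  have IH: "(\<Sum>i=1..Suc n. g i) =
    (\<Sum>i=1..n. f i) + (g j - f j) + g (Suc j) + (if j < n then g (Suc (Suc j)) - f (Suc j) else 0)"
    using step.IH step.prems by simp
  have "(\<Sum>i=1..Suc (Suc n). g i) = (\<Sum>i=1..Suc n. g i) + g (Suc (Suc n))"
    by simp
  moreover have "(\<Sum>i=1..Suc n. f i) = (\<Sum>i=1..n. f i) + f (Suc n)"
    by simp
  \<comment> \<open>For \<open>j = n\<close> the new top summand is itself the exceptional one, and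
    this is where the correction enters.\<close>
  moreover have "g (Suc (Suc n)) = f (Suc n)" if "j \<noteq> n"
    using step.prems[of "Suc n"] step.hyps that by simp
  ultimately show ?case
    using step.hyps unfolding IH by (cases "j = n") auto
qed

text \<open>Local form of the definition: one-step recursions replace the partial sums, so that a
  refinement affects the conditions only near the halved interval.\<close>

lemma is_discretization_iff:
  "is_discretization T D \<longleftrightarrow>
     1 \<le> size_of D \<and> time_of D 0 = 0 \<and> time_of D (size_of D) = T \<and>
     (\<forall>k<size_of D. 0 < step_of D (Suc k) \<and> time_of D (Suc k) = time_of D k + step_of D (Suc k)) \<and>
     (\<forall>k\<le>size_of D. 0 < mesh_of D k)"
proof -
  have times: "(\<forall>k\<in>{0..n}. t k = (\<Sum>j=1..k. h j)) \<longleftrightarrow>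
      t 0 = 0 \<and> (\<forall>k<n. t (Suc k) = t k + h (Suc k))" (is "?l \<longleftrightarrow> ?r")
    for t h :: "nat \<Rightarrow> real" and n
  proof
    assume ?l
    then show ?r by auto
  next
    assume r: ?r
    have "t k = (\<Sum>j=1..k. h j)" if "k \<le> n" for k
      using that r by (induction k) auto
    then show ?l by auto
  qed
  have steps: "(\<forall>j\<in>{1..n}. 0 < h j) \<longleftrightarrow> (\<forall>k<n. 0 < h (Suc k))" for h :: "nat \<Rightarrow> real" and n
    unfolding image_Suc_lessThan[symmetric] by auto
  let ?times = "\<forall>k\<in>{0..size_of D}. time_of D k = (\<Sum>j=1..k. step_of D j)"
  note rec = times[of "size_of D" "time_of D" "step_of D"]
  show ?thesis
  proof (cases ?times)
    case True
    then have "(\<Sum>j=1..size_of D. step_of D j) = time_of D (size_of D)"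
      by simp
    moreover have "time_of D 0 = 0" "\<forall>k<size_of D. time_of D (Suc k) = time_of D k + step_of D (Suc k)"
      using True unfolding rec by auto
    ultimately show ?thesis
      using True unfolding is_discretization_def steps by auto
  next
    case False
    then show ?thesis
      using rec unfolding is_discretization_def by blast
  qed
qed

lemma discretization_time_mono:
  assumes "is_discretization T D" "i \<le> j" "j \<le> size_of D"
  shows "time_of D i \<le> time_of D j"
  using assms(2,3)
proof (induction j rule: dec_induct)
  case (step k)
  then have "0 < step_of D (Suc k)" "time_of D (Suc k) = time_of D k + step_of D (Suc k)"
    using assms(1) unfolding is_discretization_iff by auto
  then show ?case
    using step by simp
qed simp

lemma discretization_time_range:
  assumes "is_discretization T D" "j \<le> size_of D"
  shows "0 \<le> time_of D j" "time_of D j \<le> T"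
proof -
  have "time_of D 0 = 0" "time_of D (size_of D) = T"
    using assms(1) unfolding is_discretization_iff by auto
  then show "0 \<le> time_of D j" "time_of D j \<le> T"
    using discretization_time_mono[OF assms(1), of 0 j] assms(2)
      discretization_time_mono[OF assms(1), of j "size_of D"] by simp_all
qed

section \<open>Refinement preserves discretizations\<close>

lemma refine_0_sel [simp]:
  "size_of (refine D 0) = size_of D" "step_of (refine D 0) = step_of D"
  "time_of (refine D 0) = time_of D" "mesh_of (refine D 0) = (mesh_of D)(0 := mesh_of D 0 / 4)"
  by (simp_all add: refine_def)

lemma refine_sel:
  assumes "1 \<le> j"
  shows "size_of (refine D j) = Suc (size_of D)"
    "step_of (refine D j) i = (if i < j then step_of D i
       else if i \<le> Suc j then step_of D j / 2 else step_of D (i - 1))"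
    "time_of (refine D j) i = (if i < j then time_of D i
       else if i = j then time_of D j - step_of D j / 2 else time_of D (i - 1))"
    "mesh_of (refine D j) i = (if i < j then mesh_of D i
       else if i \<le> Suc j then mesh_of D j / 4 else mesh_of D (i - 1))"
  using assms by (simp_all add: refine_def)

text \<open>Positions of the interval from node \<open>k\<close> to node \<open>Suc k\<close>
  relative to the new node \<open>j\<close>: before the halved interval, its left half, its right
  half, or a later interval shifted by one.\<close>

lemma less_cases_around:
  fixes k j :: nat
  obtains "Suc k < j" | "Suc k = j" | "k = j" | l where "k = Suc l" "j \<le> l"
  by (metis Suc_lessI less_Suc_eq_le linorder_neqE_nat not_less_eq less_imp_Suc_add le_add1 Suc_leI)

lemma is_discretization_refine:
  assumes D: "is_discretization T D" and j: "j \<le> size_of D"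
  shows "is_discretization T (refine D j)"
proof (cases "j = 0")
  case True
  then show ?thesis
    using D unfolding is_discretization_iff by simp
next
  case False
  then have j1: "1 \<le> j" by simp
  then obtain i where i: "j = Suc i" by (cases j) auto
  have steps: "0 < step_of D (Suc k)" "time_of D (Suc k) = time_of D k + step_of D (Suc k)"
    if "k < size_of D" for k
    using D that unfolding is_discretization_iff by auto
  have mesh: "0 < mesh_of D k" if "k \<le> size_of D" for k
    using D that unfolding is_discretization_iff by auto
  have "0 < step_of (refine D j) (Suc k) \<and>
      time_of (refine D j) (Suc k) = time_of (refine D j) k + step_of (refine D j) (Suc k)"
    if k: "k < Suc (size_of D)" for k
  proof (cases rule: less_cases_around[of k j])
    case 1
    then show ?thesis using j steps[of k] by (simp add: refine_sel[OF j1])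
  next
    case 2
    then show ?thesis using j steps[of k] by (simp add: refine_sel[OF j1])
  next
    case 3
    have "0 < step_of D j"
      using steps[of i] i j by simp
    then show ?thesis unfolding 3 by (simp add: refine_sel[OF j1])
  next
    case (4 l)
    then show ?thesis using j k steps[of l] by (simp add: refine_sel[OF j1])
  qed
  moreover have "0 < mesh_of (refine D j) k" if "k \<le> Suc (size_of D)" for k
    using that j mesh by (auto simp: refine_sel[OF j1])
  moreover have "time_of (refine D j) 0 = 0" "time_of (refine D j) (Suc (size_of D)) = T"
    using D j j1 unfolding is_discretization_iff by (auto simp: refine_sel[OF j1])
  ultimately show ?thesis
    unfolding is_discretization_iff by (simp add: refine_sel(1)[OF j1])
qed

text \<open>Invariant of all refinements: meshes only decrease, and halving a step while quartering
  its mesh doubles their ratio. Together the two bounds keep weights away from 0.\<close>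

definition mesh_bounded :: "real \<Rightarrow> real \<Rightarrow> discretization \<Rightarrow> bool" where
  "mesh_bounded r \<kappa> D \<longleftrightarrow>
     (\<forall>j\<le>size_of D. mesh_of D j \<le> r) \<and> (\<forall>j\<in>{1..size_of D}. \<kappa> \<le> step_of D j / mesh_of D j)"

lemma mesh_bounded_refine:
  assumes D: "is_discretization T D" and b: "mesh_bounded r \<kappa> D" and j: "j \<le> size_of D"
  shows "mesh_bounded r \<kappa> (refine D j)"
proof -
  have pos: "0 < mesh_of D j" if "j \<le> size_of D" for j
    using D that unfolding is_discretization_iff by auto
  have step: "0 < step_of D j" if "j \<in> {1..size_of D}" for j
    using D that unfolding is_discretization_def by auto
  have "mesh_of D j \<le> r"
    using b j unfolding mesh_bounded_def by auto
  with pos[OF j] have quarter: "mesh_of D j / 4 \<le> r"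
    by simp
  show ?thesis
  proof (cases "j = 0")
    case True
    then show ?thesis
      using b quarter unfolding mesh_bounded_def by auto
  next
    case False
    then have j1: "1 \<le> j" by simp
    have "\<kappa> \<le> step_of D j / mesh_of D j"
      using b j j1 unfolding mesh_bounded_def by auto
    also have "\<dots> \<le> (step_of D j / 2) / (mesh_of D j / 4)"
      using pos[of j] step[of j] j j1 by (simp add: field_simps)
    finally have "\<kappa> \<le> (step_of D j / 2) / (mesh_of D j / 4)" .
    moreover have "i - 1 \<le> size_of D" "i - 1 \<in> {1..size_of D}"
      if "\<not> i \<le> Suc j" "i \<le> Suc (size_of D)" for i
      using that by auto
    ultimately show ?thesis
      using b quarter j unfolding mesh_bounded_def
      by (auto simp: refine_sel[OF j1])
  qed
qed


section \<open>The error bound\<close>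

lemma err_term_pos:
  assumes "0 < L" "0 < P" "is_discretization T D" "j \<le> size_of D"
  shows "0 < err_term L P T D j"
proof -
  have "0 < mesh_of D j"
    using assms unfolding is_discretization_iff by auto
  moreover have "0 < step_of D j" if "j \<noteq> 0"
    using assms that unfolding is_discretization_def by auto
  ultimately show ?thesis
    using assms unfolding err_term_def by (auto intro!: mult_pos_pos add_pos_pos)
qed

lemma err_split: "err L P T D = err_term L P T D 0 + (\<Sum>j=1..size_of D. err_term L P T D j)"
  unfolding err_def by (simp add: sum.atLeast_Suc_atMost)

text \<open>The exponential prefactors of the two halves add up to that of the whole interval. The
  bracket is the same for both halves and at most half the old one, since the step and the quotient
  of mesh and step are halved and the mesh is quartered. For \<open>j = 0\<close> the term is
  divided by 4.\<close>

lemma delta_err_ge: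
  assumes L: "0 < L" and P: "0 < P" and D: "is_discretization T D" and j: "j \<le> size_of D"
  shows "err_term L P T D j / 2 \<le> - delta_err L P T D j"
proof (cases "j = 0")
  case True
  have "0 < err_term L P T D 0"
    using err_term_pos[OF L P D] by simp
  moreover have "(\<Sum>j=1..size_of D. err_term L P T (refine D 0) j) = (\<Sum>j=1..size_of D. err_term L P T D j)"
    by (intro sum.cong) (auto simp: err_term_def)
  moreover have "err_term L P T (refine D 0) 0 = err_term L P T D 0 / 4"
    by (simp add: err_term_def)
  ultimately show ?thesis
    by (simp add: True delta_err_def err_split)
next
  case False
  then have j1: "1 \<le> j" by simp
  define h where "h = step_of D j"
  define \<rho> where "\<rho> = mesh_of D j"
  define a where "a = exp (L * (T - time_of D j))"
  define e where "e = exp (L * (h / 2))"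
  let ?g = "err_term L P T (refine D j)" and ?f = "err_term L P T D"
  have h: "0 < h"
    using D j j1 unfolding is_discretization_def h_def by auto
  have \<rho>: "0 < \<rho>"
    using D j unfolding is_discretization_iff \<rho>_def by auto
  have e2: "exp (L * h) = e * e"
    unfolding e_def by (simp flip: exp_add)
  have e1: "1 < e"
    using L h by (simp add: e_def)
  have a: "0 < a"
    by (simp add: a_def)
  have expand: "exp (L * (T - (time_of D j - h / 2))) = a * e"
    unfolding a_def e_def by (simp add: algebra_simps flip: exp_add)
  have fj: "?f j = a * (e * e - 1) * (P * h + \<rho> / 2 + \<rho> / (2 * L * h))"
    using False by (simp add: err_term_def a_def e2[symmetric] h_def \<rho>_def)
  have gj: "?g j = a * e * (e - 1) * (P * (h / 2) + (\<rho> / 4) / 2 + (\<rho> / 4) / (2 * L * (h / 2)))"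
    using False expand by (simp add: err_term_def refine_sel[OF j1] e_def flip: h_def \<rho>_def)
  have gj': "?g (Suc j) = a * (e - 1) * (P * (h / 2) + (\<rho> / 4) / 2 + (\<rho> / 4) / (2 * L * (h / 2)))"
    by (simp add: err_term_def refine_sel[OF j1] a_def e_def flip: h_def \<rho>_def)
  have "?g j + ?g (Suc j) =
      a * (e * e - 1) * (P * (h / 2) + (\<rho> / 4) / 2 + (\<rho> / 4) / (2 * L * (h / 2)))"
    unfolding gj gj' distrib_right[symmetric] by (simp add: algebra_simps)
  also have "\<dots> \<le> a * (e * e - 1) * ((P * h + \<rho> / 2 + \<rho> / (2 * L * h)) / 2)"
  proof (intro mult_left_mono)
    show "0 \<le> a * (e * e - 1)"
      using a e1 by (simp add: mult_ge1_I less_imp_le)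
    show "P * (h / 2) + (\<rho> / 4) / 2 + (\<rho> / 4) / (2 * L * (h / 2)) \<le>
        (P * h + \<rho> / 2 + \<rho> / (2 * L * h)) / 2"
      using L h \<rho> by (simp add: field_simps)
  qed
  also have "\<dots> = ?f j / 2"
    unfolding fj by simp
  finally have half: "?g j + ?g (Suc j) \<le> ?f j / 2" .
  \<comment> \<open>Error terms use only data of their own index, so even the term after the halved
    interval is merely shifted and its correction vanishes.\<close>
  have after: "?g (Suc i) = ?f i" if "j < i" for i
    using that by (auto simp: err_term_def refine_sel[OF j1])
  have "(\<Sum>i=1..Suc (size_of D). ?g i) =
    (\<Sum>i=1..size_of D. ?f i) + (?g j - ?f j) + ?g (Suc j) +
      (if j < size_of D then ?g (Suc (Suc j)) - ?f (Suc j) else 0)"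
    using j1 j after
    by (intro sum_insert_index) (auto simp: err_term_def refine_sel[OF j1])
  moreover have "?g 0 = ?f 0"
    using False by (simp add: err_term_def refine_sel[OF j1])
  ultimately have "- delta_err L P T D j = ?f j - ?g j - ?g (Suc j)"
    using after[of "Suc j"] by (simp add: delta_err_def err_split refine_sel(1)[OF j1])
  then show ?thesis
    using half by simp
qed


section \<open>The cost estimator\<close>

text \<open>The summands of \<open>cost\<close>, indexed by the interval \<open>i\<close> instead of
  its left node \<open>i - 1\<close>.\<close>

definition cost_term ::
    "real \<Rightarrow> real \<Rightarrow> (real \<Rightarrow> real) \<Rightarrow> (real \<Rightarrow> real) \<Rightarrow> discretization \<Rightarrow> nat \<Rightarrow> real" where
  "cost_term dR dF uR uF D i =
     uR (time_of D (i - 1)) * uF (time_of D (i - 1)) / mesh_of D (i - 1) powr dR *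
     (step_of D i / mesh_of D i) powr dF"

text \<open>Uses the mesh at the right node \<open>i\<close>, unlike \<open>cost_term\<close>. Up to
  a constant and the values of the estimators, this is the cost summand that appears at the midpoint
  when interval \<open>i\<close> is halved.\<close>

definition weight :: "real \<Rightarrow> real \<Rightarrow> discretization \<Rightarrow> nat \<Rightarrow> real" where
  "weight dR dF D i = 1 / mesh_of D i powr dR * (step_of D i / mesh_of D i) powr dF"

definition total_weight :: "real \<Rightarrow> real \<Rightarrow> discretization \<Rightarrow> real" where
  "total_weight dR dF D = (\<Sum>i=1..size_of D. weight dR dF D i)"

lemma cost_eq_sum:
  assumes "is_discretization T D"
  shows "cost dR dF uR uF D = (\<Sum>i=1..size_of D. cost_term dR dF uR uF D i)"
proof -
  have "cost dR dF uR uF D = (\<Sum>j=0..<size_of D. cost_term dR dF uR uF D (Suc j))"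
    unfolding cost_def
  proof (intro sum.cong refl)
    fix j
    assume "j \<in> {0..<size_of D}"
    then have "0 < step_of D (Suc j)" "0 < mesh_of D (Suc j)"
      using assms unfolding is_discretization_iff by auto
    then show "uR (time_of D j) / mesh_of D j powr dR *
        (uF (time_of D j) * step_of D (Suc j) powr dF / mesh_of D (Suc j) powr dF) =
        cost_term dR dF uR uF D (Suc j)"
      by (simp add: cost_term_def powr_divide)
  qed
  also have "\<dots> = (\<Sum>i=1..size_of D. cost_term dR dF uR uF D i)"
    by (simp add: sum.atLeast1_atMost_eq atLeast0LessThan)
  finally show ?thesis .
qed

section \<open>Effect of a refinement on weights and cost\<close>

lemma powr_refined_ratio: "(h / 2 / (\<rho> / 4)) powr a = 2 powr a * (h / \<rho>) powr a" if "0 < h" "0 < \<rho>" for h \<rho> a :: real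
proof -
  have "h / 2 / (\<rho> / 4) = 2 * (h / \<rho>)"
    using that by (simp add: field_simps)
  then show ?thesis
    using that by (simp only: powr_mult)
qed

lemma weight_refine:
  assumes D: "is_discretization T D" and j: "1 \<le> j" "j \<le> size_of D" and i: "i = j \<or> i = Suc j"
  shows "weight dR dF (refine D j) i = 4 powr dR * 2 powr dF * weight dR dF D j"
proof -
  have pos: "0 < step_of D j" "0 < mesh_of D j"
    using D j unfolding is_discretization_def by auto
  then have "(mesh_of D j / 4) powr dR = mesh_of D j powr dR / 4 powr dR"
    by (simp add: powr_divide)
  then show ?thesis
    using i powr_refined_ratio[OF pos, of dF] by (auto simp: weight_def refine_sel[OF j(1)])
qed

lemma total_weight_refine:
  assumes D: "is_discretization T D" and j: "1 \<le> j" "j \<le> size_of D"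
  shows "total_weight dR dF (refine D j) =
    total_weight dR dF D + (2 * (4 powr dR * 2 powr dF) - 1) * weight dR dF D j"
proof -
  let ?g = "weight dR dF (refine D j)" and ?f = "weight dR dF D"
  have after: "?g (Suc i) = ?f i" if "j < i" for i
    using that by (auto simp: weight_def refine_sel[OF j(1)])
  have "(\<Sum>i=1..Suc (size_of D). ?g i) =
    (\<Sum>i=1..size_of D. ?f i) + (?g j - ?f j) + ?g (Suc j) +
      (if j < size_of D then ?g (Suc (Suc j)) - ?f (Suc j) else 0)"
    using j after by (intro sum_insert_index) (auto simp: weight_def refine_sel[OF j(1)])
  then show ?thesis
    using after[of "Suc j"] weight_refine[OF D j, of j dR dF] weight_refine[OF D j, of "Suc j" dR dF]
    by (simp add: total_weight_def refine_sel(1)[OF j(1)] algebra_simps)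
qed

lemma total_weight_refine_0 [simp]: "total_weight dR dF (refine D 0) = total_weight dR dF D"
  unfolding total_weight_def by (auto intro!: sum.cong simp: weight_def)

text \<open>The mesh at node 0 enters the first cost term alone, through the power with exponent
  \<open>dR\<close>.\<close>

lemma delta_cost_0:
  assumes D: "is_discretization T D"
  shows "delta_cost dR dF uR uF D 0 = (4 powr dR - 1) * cost_term dR dF uR uF D 1"
proof -
  let ?g = "cost_term dR dF uR uF (refine D 0)" and ?f = "cost_term dR dF uR uF D"
  have n: "1 \<le> size_of D" and m: "0 < mesh_of D 0"
    using D unfolding is_discretization_iff by auto
  have "(\<Sum>i=1..size_of D. ?g i) = ?g 1 + (\<Sum>i=2..size_of D. ?g i)"
    using n by (simp add: sum.atLeast_Suc_atMost numeral_2_eq_2)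
  also have "(\<Sum>i=2..size_of D. ?g i) = (\<Sum>i=2..size_of D. ?f i)"
    by (intro sum.cong) (auto simp: cost_term_def)
  also have "?g 1 = 4 powr dR * ?f 1"
    using m by (simp add: cost_term_def powr_divide)
  finally have "(\<Sum>i=1..size_of D. ?g i) = (4 powr dR - 1) * ?f 1 + (?f 1 + (\<Sum>i=2..size_of D. ?f i))"
    by (simp add: algebra_simps)
  also have "?f 1 + (\<Sum>i=2..size_of D. ?f i) = (\<Sum>i=1..size_of D. ?f i)"
    using n by (simp add: sum.atLeast_Suc_atMost numeral_2_eq_2)
  finally show ?thesis
    using cost_eq_sum[OF D] cost_eq_sum[OF is_discretization_refine[OF D, of 0]]
    by (simp add: delta_cost_def)
qed

text \<open>Three contributions: the left half keeps its left node and doubles the ratio of step and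
  mesh; the right half starts at the midpoint \<open>s\<close> with a quartered mesh; the next
  interval, if there is one, sees a quartered mesh at its left node.\<close>

lemma delta_cost_pos_index:
  assumes D: "is_discretization T D" and j: "1 \<le> j" "j \<le> size_of D"
  defines "s \<equiv> time_of D j - step_of D j / 2"
  shows "delta_cost dR dF uR uF D j =
    (2 powr dF - 1) * cost_term dR dF uR uF D j +
    uR s * uF s * (4 powr dR * 2 powr dF * weight dR dF D j) +
    (if j < size_of D then (4 powr dR - 1) * cost_term dR dF uR uF D (Suc j) else 0)"
proof -
  let ?g = "cost_term dR dF uR uF (refine D j)" and ?f = "cost_term dR dF uR uF D"
  have pos: "0 < step_of D j" "0 < mesh_of D j"
    using D j unfolding is_discretization_def by auto
  have quarter: "(mesh_of D j / 4) powr dR = mesh_of D j powr dR / 4 powr dR"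
    using pos by (simp add: powr_divide)
  have after: "?g (Suc i) = ?f i" if "Suc j < i" for i
    using that by (auto simp: cost_term_def refine_sel[OF j(1)])
  have "?g i = ?f i" if "i < j" for i
    using that by (auto simp: cost_term_def refine_sel[OF j(1)])
  then have "(\<Sum>i=1..Suc (size_of D). ?g i) =
    (\<Sum>i=1..size_of D. ?f i) + (?g j - ?f j) + ?g (Suc j) +
      (if j < size_of D then ?g (Suc (Suc j)) - ?f (Suc j) else 0)"
    using j after by (intro sum_insert_index) auto
  moreover have "?g j = 2 powr dF * ?f j"
    using j(1) powr_refined_ratio[OF pos, of dF] by (simp add: cost_term_def refine_sel[OF j(1)])
  moreover have "?g (Suc j) = uR s * uF s * (4 powr dR * 2 powr dF * weight dR dF D j)"
    using powr_refined_ratio[OF pos, of dF]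
    by (simp add: cost_term_def weight_def refine_sel[OF j(1)] quarter s_def)
  moreover have "?g (Suc (Suc j)) = 4 powr dR * ?f (Suc j)"
    by (simp add: cost_term_def refine_sel[OF j(1)] quarter)
  ultimately show ?thesis
    using cost_eq_sum[OF D] cost_eq_sum[OF is_discretization_refine[OF D j(2)]]
    by (simp add: delta_cost_def refine_sel(1)[OF j(1)] algebra_simps)
qed


section \<open>Greedy refinement\<close>

text \<open>The situation between two evaluations of the estimators: they are fixed, and
  \<open>b\<close> and \<open>B\<close> bound their product, the combination in which they enter the
  cost. Positivity of \<open>dR\<close> makes a refinement of the initial mesh strictly
  costly.\<close>

locale refinement_potential =
  fixes L P T dR dF r \<kappa> b B :: real and uR uF :: "real \<Rightarrow> real"
  assumes L_pos: "0 < L" and P_pos: "0 < P" and dR_pos: "0 < dR" and dF_nonneg: "0 \<le> dF"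
    and r_pos: "0 < r" and \<kappa>_pos: "0 < \<kappa>" and b_pos: "0 < b"
    and lower: "\<And>s. s \<in> {0..T} \<Longrightarrow> b \<le> uR s * uF s"
    and upper: "\<And>s. s \<in> {0..T} \<Longrightarrow> uR s * uF s \<le> B"
begin

definition admissible :: "discretization \<Rightarrow> bool" where
  "admissible D \<longleftrightarrow> is_discretization T D \<and> mesh_bounded r \<kappa> D"

definition potential :: "discretization \<Rightarrow> real" where
  "potential D = cost dR dF uR uF D + total_weight dR dF D"

definition min_weight :: real where
  "min_weight = 1 / r powr dR * \<kappa> powr dF"

abbreviation gain :: "discretization \<Rightarrow> nat \<Rightarrow> real" where
  "gain D j \<equiv> - delta_err L P T D j / delta_cost dR dF uR uF D j"

lemma min_weight_pos: "0 < min_weight"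
  using r_pos \<kappa>_pos by (simp add: min_weight_def)

lemma admissible_discretization: "admissible D \<Longrightarrow> is_discretization T D"
  by (simp add: admissible_def)

lemma admissible_refine: "admissible D \<Longrightarrow> j \<le> size_of D \<Longrightarrow> admissible (refine D j)"
  using is_discretization_refine mesh_bounded_refine unfolding admissible_def by blast

lemma four_powr: "1 < 4 powr dR"
  using dR_pos by simp

lemma two_powr: "1 \<le> 2 powr dF"
  using dF_nonneg by (simp add: ge_one_powr_ge_zero)

lemma factor_ge_1: "1 \<le> 4 powr dR * 2 powr dF"
  using four_powr two_powr by (simp add: mult_ge1_I)

lemma B_pos:
  assumes "admissible D"
  shows "0 < B"
proof -
  have "time_of D 0 \<in> {0..T}"
    using discretization_time_range[OF admissible_discretization[OF assms], of 0] by simp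
  from lower[OF this] upper[OF this] b_pos show ?thesis
    by linarith
qed

section \<open>Uniform lower bounds for weights, cost terms and cost increments\<close>

lemma mesh_factor_ge:
  assumes "admissible D" "i \<le> size_of D"
  shows "1 / r powr dR \<le> 1 / mesh_of D i powr dR"
proof -
  have "0 < mesh_of D i" "mesh_of D i \<le> r"
    using assms unfolding admissible_def is_discretization_iff mesh_bounded_def by auto
  then show ?thesis
    using dR_pos by (intro divide_left_mono powr_mono2 mult_pos_pos) auto
qed

lemma ratio_factor_ge:
  assumes "admissible D" "i \<in> {1..size_of D}"
  shows "\<kappa> powr dF \<le> (step_of D i / mesh_of D i) powr dF"
  using assms dF_nonneg \<kappa>_pos unfolding admissible_def mesh_bounded_def
  by (auto intro!: powr_mono2)

lemma weight_ge:
  assumes "admissible D" "i \<in> {1..size_of D}"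
  shows "min_weight \<le> weight dR dF D i"
  using mesh_factor_ge[of D i] ratio_factor_ge[of D i] assms
  unfolding min_weight_def weight_def by (intro mult_mono) auto

lemma cost_term_ge:
  assumes D: "admissible D" and i: "i \<in> {1..size_of D}"
  shows "b * min_weight \<le> cost_term dR dF uR uF D i"
proof -
  have "time_of D (i - 1) \<in> {0..T}"
    using D i discretization_time_range[of T D "i - 1"] unfolding admissible_def by auto
  then have "b * min_weight \<le> uR (time_of D (i - 1)) * uF (time_of D (i - 1)) *
      (1 / mesh_of D (i - 1) powr dR * (step_of D i / mesh_of D i) powr dF)"
    unfolding min_weight_def
    using mesh_factor_ge[OF D, of "i - 1"] ratio_factor_ge[OF D i] i lower b_pos
    by (intro mult_mono) (auto intro: order.trans less_imp_le)
  then show ?thesis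
    by (simp add: cost_term_def mult.assoc)
qed

lemma cost_term_nonneg:
  assumes "admissible D" "i \<in> {1..size_of D}"
  shows "0 \<le> cost_term dR dF uR uF D i"
  using cost_term_ge[OF assms] b_pos min_weight_pos by (smt (verit) mult_pos_pos)

text \<open>The midpoint is node \<open>j\<close> of the refined discretization.\<close>

lemma midpoint_in_range:
  assumes D: "admissible D" and j: "1 \<le> j" "j \<le> size_of D"
  shows "time_of D j - step_of D j / 2 \<in> {0..T}"
proof -
  have "is_discretization T (refine D j)"
    using admissible_refine[OF D j(2)] by (simp add: admissible_def)
  from discretization_time_range[OF this, of j] show ?thesis
    using j by (simp add: refine_sel[OF j(1)])
qed

text \<open>Of the three contributions to the increment the one starting at the midpoint is kept;
  the others are nonnegative. The bound later pays for the growth of the total weight.\<close>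

lemma delta_cost_ge:
  assumes D: "admissible D" and j: "1 \<le> j" "j \<le> size_of D"
  shows "b * (4 powr dR * 2 powr dF * weight dR dF D j) \<le> delta_cost dR dF uR uF D j"
proof -
  let ?s = "time_of D j - step_of D j / 2" and ?x = "4 powr dR * 2 powr dF * weight dR dF D j"
  have "b * ?x \<le> uR ?s * uF ?s * ?x"
    using lower[OF midpoint_in_range[OF D j]] weight_ge[OF D, of j] j min_weight_pos
    by (intro mult_right_mono) auto
  moreover have "0 \<le> (2 powr dF - 1) * cost_term dR dF uR uF D j"
    using cost_term_nonneg[OF D, of j] j two_powr by simp
  moreover have "0 \<le> (if j < size_of D then (4 powr dR - 1) * cost_term dR dF uR uF D (Suc j) else 0)"
    using cost_term_nonneg[OF D, of "Suc j"] four_powr by simp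
  ultimately show ?thesis
    using delta_cost_pos_index[OF admissible_discretization[OF D] j, of dR dF uR uF] by linarith
qed

lemma delta_cost_0_ge:
  assumes D: "admissible D"
  shows "(4 powr dR - 1) * (b * min_weight) \<le> delta_cost dR dF uR uF D 0"
  using D cost_term_ge[OF D, of 1] four_powr
  unfolding admissible_def by (auto simp: delta_cost_0[of T D] is_discretization_iff)

lemma delta_cost_pos:
  assumes D: "admissible D" and j: "j \<le> size_of D"
  shows "0 < delta_cost dR dF uR uF D j"
proof (cases "j = 0")
  case True
  have "0 < (4 powr dR - 1) * (b * min_weight)"
    using four_powr b_pos min_weight_pos by simp
  then show ?thesis
    using delta_cost_0_ge[OF D] True by simp
next
  case False
  then have "0 < b * (4 powr dR * 2 powr dF * weight dR dF D j)"
    using weight_ge[OF D, of j] j b_pos min_weight_pos factor_ge_1 by simp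
  then show ?thesis
    using delta_cost_ge[OF D _ j] False by simp
qed

section \<open>Growth of the potential under refinement\<close>

text \<open>The total weight grows by at most twice the scaled weight of \<open>j\<close>, and
  \<open>b\<close> times that scaled weight is at most the cost increment; hence the summand
  \<open>2 / b\<close>. For \<open>j = 0\<close> the total weight is unchanged.\<close>

lemma potential_refine_le:
  assumes D: "admissible D" and j: "j \<le> size_of D"
  shows "potential (refine D j) - potential D \<le> (1 + 2 / b) * delta_cost dR dF uR uF D j"
proof (cases "j = 0")
  case True
  then show ?thesis
    using delta_cost_pos[OF D j] b_pos
    by (simp add: potential_def delta_cost_def[symmetric] algebra_simps)
next
  case False
  then have j1: "1 \<le> j" by simp
  let ?x = "4 powr dR * 2 powr dF"
  have w: "0 \<le> weight dR dF D j"
    using weight_ge[OF D, of j] j1 j min_weight_pos by simp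
  have "total_weight dR dF (refine D j) - total_weight dR dF D = (2 * ?x - 1) * weight dR dF D j"
    using total_weight_refine[OF admissible_discretization[OF D] j1 j] by simp
  also have "\<dots> \<le> 2 / b * (b * (?x * weight dR dF D j))"
    using w b_pos by (simp add: algebra_simps)
  also have "\<dots> \<le> 2 / b * delta_cost dR dF uR uF D j"
    using delta_cost_ge[OF D j1 j] b_pos by (intro mult_left_mono) auto
  finally show ?thesis
    by (simp add: potential_def delta_cost_def algebra_simps)
qed

text \<open>For positive \<open>j\<close> the total weight alone gains \<open>min_weight\<close>;
  for \<open>j = 0\<close> the gain comes from the cost and is positive because
  \<open>4 powr dR > 1\<close>.\<close>

lemma potential_refine_ge:
  assumes D: "admissible D" and j: "j \<le> size_of D"
  shows "potential D + min min_weight ((4 powr dR - 1) * (b * min_weight)) \<le> potential (refine D j)"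
proof (cases "j = 0")
  case True
  then show ?thesis
    using delta_cost_0_ge[OF D] by (simp add: potential_def delta_cost_def)
next
  case False
  then have j1: "1 \<le> j" by simp
  have "1 * min_weight \<le> (2 * (4 powr dR * 2 powr dF) - 1) * weight dR dF D j"
    using weight_ge[OF D, of j] j1 j min_weight_pos factor_ge_1 by (intro mult_mono) auto
  then show ?thesis
    using delta_cost_pos[OF D j] total_weight_refine[OF admissible_discretization[OF D] j1 j, of dR dF]
    by (simp add: potential_def delta_cost_def)
qed

lemma potential_pos:
  assumes "admissible D"
  shows "0 < potential D"
proof -
  have n: "1 \<le> size_of D" and D: "is_discretization T D"
    using assms unfolding admissible_def is_discretization_def by auto
  have "0 < total_weight dR dF D"
    unfolding total_weight_def using weight_ge[OF assms] min_weight_pos n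
    by (intro sum_pos) (auto intro: less_le_trans)
  moreover have "0 \<le> cost dR dF uR uF D"
    unfolding cost_eq_sum[OF D] using cost_term_nonneg[OF assms] by (intro sum_nonneg) auto
  ultimately show ?thesis
    by (simp add: potential_def)
qed

section \<open>The greedy choice of the index\<close>

text \<open>The first two summands account for the old cost terms, the last one for the new midpoint
  summands measured by the weights.\<close>

definition growth :: real where
  "growth = 2 powr dF + 4 powr dR + B * (4 powr dR * 2 powr dF)"

lemma growth_pos: "admissible D \<Longrightarrow> 0 < growth"
  unfolding growth_def using B_pos by (intro add_pos_pos mult_pos_pos) auto

text \<open>An old cost term occurs in two increments, that of its own interval with factor
  \<open>2 powr dF - 1\<close> and that of its left node with factor \<open>4 powr dR - 1\<close>.
  The midpoint summands are at most \<open>B\<close> times the scaled weights.\<close>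

lemma sum_delta_cost_le:
  assumes adm: "admissible D"
  shows "(\<Sum>j=0..size_of D. delta_cost dR dF uR uF D j) \<le> growth * potential D"
proof -
  let ?n = "size_of D" and ?c = "cost_term dR dF uR uF D" and ?x = "4 powr dR * 2 powr dF"
  have D: "is_discretization T D"
    using adm by (simp add: admissible_def)
  have c0: "0 \<le> ?c i" if "i \<in> {1..?n}" for i
    using cost_term_nonneg[OF adm that] .
  have C0: "0 \<le> cost dR dF uR uF D"
    unfolding cost_eq_sum[OF D] using c0 by (intro sum_nonneg) auto
  have W0: "0 \<le> total_weight dR dF D"
    unfolding total_weight_def using weight_ge[OF adm] min_weight_pos
    by (intro sum_nonneg) (auto intro: order.trans less_imp_le)
  \<comment> \<open>The part of the increment caused by quartering the mesh at node
    \<open>j\<close>; the last node begins no interval.\<close>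
  define up where "up j = (if j < ?n then (4 powr dR - 1) * ?c (Suc j) else 0)" for j
  have "delta_cost dR dF uR uF D j \<le>
      (2 powr dF - 1) * ?c j + B * (?x * weight dR dF D j) + up j"
    if "j \<in> {1..?n}" for j
  proof -
    have j: "1 \<le> j" "j \<le> ?n" using that by auto
    let ?s = "time_of D j - step_of D j / 2"
    have "uR ?s * uF ?s * (?x * weight dR dF D j) \<le> B * (?x * weight dR dF D j)"
      using upper[OF midpoint_in_range[OF adm j]] weight_ge[OF adm, of j] j min_weight_pos
      by (intro mult_right_mono) auto
    then show ?thesis
      using delta_cost_pos_index[OF D j, of dR dF uR uF] by (simp add: up_def)
  qed
  then have "(\<Sum>j=1..?n. delta_cost dR dF uR uF D j) \<le>
      (\<Sum>j=1..?n. (2 powr dF - 1) * ?c j + B * (?x * weight dR dF D j) + up j)"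
    by (intro sum_mono)
  also have "\<dots> = (2 powr dF - 1) * cost dR dF uR uF D + B * (?x * total_weight dR dF D)
      + (\<Sum>j=1..?n. up j)"
    by (simp add: sum.distrib cost_eq_sum[OF D] total_weight_def flip: sum_distrib_left)
  finally have pos_indices: "(\<Sum>j=1..?n. delta_cost dR dF uR uF D j) \<le>
      (2 powr dF - 1) * cost dR dF uR uF D + B * (?x * total_weight dR dF D) + (\<Sum>j=1..?n. up j)" .
  \<comment> \<open>Index 0 supplies the missing summand, so that every interval is counted exactly
    once.\<close>
  have "delta_cost dR dF uR uF D 0 = up 0"
    using D by (simp add: delta_cost_0[OF D] up_def is_discretization_iff)
  then have "delta_cost dR dF uR uF D 0 + (\<Sum>j=1..?n. up j) = (\<Sum>j=0..?n. up j)"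
    by (simp add: sum.atLeast_Suc_atMost)
  also have "\<dots> = (\<Sum>j=0..<?n. up j)"
    by (simp add: up_def flip: atLeastLessThanSuc_atLeastAtMost)
  also have "\<dots> = (\<Sum>j=0..<?n. (4 powr dR - 1) * ?c (Suc j))"
    by (intro sum.cong) (auto simp: up_def)
  also have "\<dots> = (4 powr dR - 1) * (\<Sum>i=1..?n. ?c i)"
    by (simp add: sum.atLeast1_atMost_eq atLeast0LessThan sum_distrib_left)
  finally have "(\<Sum>j=0..?n. delta_cost dR dF uR uF D j) \<le>
      (2 powr dF + 4 powr dR - 2) * cost dR dF uR uF D + B * ?x * total_weight dR dF D"
    using pos_indices by (simp add: sum.atLeast_Suc_atMost cost_eq_sum[OF D] algebra_simps)
  also have "\<dots> \<le> growth * cost dR dF uR uF D + growth * total_weight dR dF D"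
    using C0 W0 B_pos[OF adm] unfolding growth_def
    by (intro add_mono mult_right_mono) (auto simp: algebra_simps)
  finally show ?thesis
    by (simp add: potential_def algebra_simps)
qed

text \<open>The largest quotient is at least the quotient of the sums: the error decrements sum to
  at least half the error, the cost increments to at most
  \<open>growth * potential D\<close>.\<close>

lemma greedy_delta_cost_le:
  assumes adm: "admissible D" and k: "is_arg_max (gain D) (\<lambda>j. j \<in> {0..size_of D}) k"
    and \<epsilon>: "\<epsilon> \<le> err L P T D"
  shows "\<epsilon> * delta_cost dR dF uR uF D k \<le> 2 * growth * potential D * - delta_err L P T D k"
proof -
  let ?n = "size_of D" and ?C = "delta_cost dR dF uR uF D" and ?E = "\<lambda>j. - delta_err L P T D j"
  have D: "is_discretization T D"
    using adm by (simp add: admissible_def)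
  have kn: "k \<le> ?n"
    using k by (simp add: is_arg_max_def)
  have opt: "gain D j \<le> gain D k" if "j \<le> ?n" for j
    using k that unfolding is_arg_max_linorder by auto
  have "0 \<le> ?E k"
    using delta_err_ge[OF L_pos P_pos D kn] err_term_pos[OF L_pos P_pos D kn] by simp
  then have gain_nonneg: "0 \<le> gain D k"
    using delta_cost_pos[OF adm kn] by (intro divide_nonneg_pos)
  have "err_term L P T D j / 2 \<le> gain D k * ?C j" if "j \<in> {0..?n}" for j
  proof -
    have j: "j \<le> ?n" using that by simp
    have "?E j = gain D j * ?C j"
      using delta_cost_pos[OF adm j] by simp
    also have "\<dots> \<le> gain D k * ?C j"
      using opt[OF j] delta_cost_pos[OF adm j] by (intro mult_right_mono) auto
    finally show ?thesis
      by (rule order.trans[OF delta_err_ge[OF L_pos P_pos D j]])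
  qed
  then have "(\<Sum>j=0..?n. err_term L P T D j / 2) \<le> (\<Sum>j=0..?n. gain D k * ?C j)"
    by (intro sum_mono)
  then have "err L P T D / 2 \<le> gain D k * (\<Sum>j=0..?n. ?C j)"
    by (simp only: err_def sum_divide_distrib sum_distrib_left)
  then have "\<epsilon> / 2 \<le> gain D k * (\<Sum>j=0..?n. ?C j)"
    using \<epsilon> by linarith
  also have "\<dots> \<le> gain D k * (growth * potential D)"
    using sum_delta_cost_le[OF adm] gain_nonneg by (intro mult_left_mono) auto
  finally have "\<epsilon> / 2 * ?C k \<le> gain D k * (growth * potential D) * ?C k"
    using delta_cost_pos[OF adm kn] by (intro mult_right_mono) auto
  then show ?thesis
    using delta_cost_pos[OF adm kn] by (simp add: field_simps)
qed

text \<open>A discrete Gronwall step: the potential grows at most by the factor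
  \<open>1 + x <= exp x\<close>, where \<open>x\<close> is \<open>A\<close> times the error
  decrement. \<open>A\<close> combines the constants of the two preceding estimates and depends on
  \<open>\<epsilon>\<close> but not on \<open>D\<close>, so the steps can be chained.\<close>

lemma greedy_potential_le:
  assumes adm: "admissible D" and k: "is_arg_max (gain D) (\<lambda>j. j \<in> {0..size_of D}) k"
    and \<epsilon>: "0 < \<epsilon>" "\<epsilon> \<le> err L P T D"
  defines "A \<equiv> (1 + 2 / b) * (2 * growth / \<epsilon>)"
  shows "potential (refine D k) * exp (A * err L P T (refine D k)) \<le> potential D * exp (A * err L P T D)"
proof -
  let ?C = "delta_cost dR dF uR uF D k" and ?e = "- delta_err L P T D k"
  have kn: "k \<le> size_of D"
    using k by (simp add: is_arg_max_def)
  have "?C \<le> 2 * growth / \<epsilon> * potential D * ?e"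
    using greedy_delta_cost_le[OF adm k \<epsilon>(2)] \<epsilon>(1) by (simp add: field_simps)
  then have "(1 + 2 / b) * ?C \<le> (1 + 2 / b) * (2 * growth / \<epsilon> * potential D * ?e)"
    using b_pos by (intro mult_left_mono) auto
  then have "potential (refine D k) \<le> potential D + A * ?e * potential D"
    using potential_refine_le[OF adm kn] by (simp add: A_def mult_ac)
  also have "\<dots> = potential D * (1 + A * ?e)"
    by (simp add: algebra_simps)
  also have "\<dots> \<le> potential D * exp (A * ?e)"
    using potential_pos[OF adm] exp_ge_add_one_self[of "A * ?e"] by (intro mult_left_mono) auto
  finally have "potential (refine D k) * exp (A * err L P T (refine D k)) \<le>
      potential D * exp (A * ?e) * exp (A * err L P T (refine D k))"
    by (intro mult_right_mono) auto
  also have "\<dots> = potential D * exp (A * err L P T D)"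
    by (simp add: delta_err_def algebra_simps flip: exp_add)
  finally show ?thesis .
qed

text \<open>The potential would be bounded along the run and yet grow at least linearly in the
  number of refinements.\<close>

lemma greedy_refinement_terminates:
  assumes D0: "admissible (D 0)" and \<epsilon>: "0 < \<epsilon>"
    and greedy: "\<And>i. \<exists>k. is_arg_max (gain (D i)) (\<lambda>j. j \<in> {0..size_of (D i)}) k \<and> D (Suc i) = refine (D i) k"
    and large: "\<And>i. \<epsilon> \<le> err L P T (D i)"
  shows False
proof -
  define A where "A = (1 + 2 / b) * (2 * growth / \<epsilon>)"
  define \<eta> where "\<eta> = min min_weight ((4 powr dR - 1) * (b * min_weight))"
  have adm: "admissible (D i)" for i
  proof (induction i)
    case (Suc i)
    then show ?case
      using greedy[of i] admissible_refine unfolding is_arg_max_def by auto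
  qed (rule D0)
  have A: "0 \<le> A"
    using b_pos growth_pos[OF D0] \<epsilon> by (simp add: A_def)
  have \<eta>: "0 < \<eta>"
    using min_weight_pos b_pos four_powr by (simp add: \<eta>_def)
  have "potential (D i) * exp (A * err L P T (D i)) \<le> potential (D 0) * exp (A * err L P T (D 0))" for i
  proof (induction i)
    case (Suc i)
    obtain k where "is_arg_max (gain (D i)) (\<lambda>j. j \<in> {0..size_of (D i)}) k" "D (Suc i) = refine (D i) k"
      using greedy by blast
    with greedy_potential_le[OF adm _ \<epsilon> large] Suc show ?case
      unfolding A_def by fastforce
  qed simp
  moreover have "potential (D i) * 1 \<le> potential (D i) * exp (A * err L P T (D i))" for i
    using potential_pos[OF adm] A large[of i] \<epsilon> by (intro mult_left_mono) (auto intro: less_imp_le)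
  ultimately have upper: "potential (D i) \<le> potential (D 0) * exp (A * err L P T (D 0))" for i
    by (metis mult.right_neutral order.trans)
  have lower: "potential (D 0) + real i * \<eta> \<le> potential (D i)" for i
  proof (induction i)
    case (Suc i)
    obtain k where "k \<le> size_of (D i)" "D (Suc i) = refine (D i) k"
      using greedy[of i] unfolding is_arg_max_def by auto
    with potential_refine_ge[OF adm] Suc show ?case
      unfolding \<eta>_def by (fastforce simp: algebra_simps)
  qed simp
  obtain i :: nat where "potential (D 0) * exp (A * err L P T (D 0)) < real i * \<eta>"
    using \<eta> reals_Archimedean3 by blast
  then show False
    using upper[of i] lower[of i] potential_pos[OF D0] by linarith
qed

end


section \<open>Positivity of the estimated volumes\<close>

text \<open>After division by \<open>r\<close> the coordinates are integers of modulus at most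
  \<open>M / r\<close>.\<close>

lemma finite_grid_bounded:
  fixes A :: "(real ^ 'n) set"
  assumes r: "0 < r" and A: "A \<subseteq> grid r" "\<And>x. x \<in> A \<Longrightarrow> infnorm x \<le> M"
  shows "finite A"
proof -
  define S where "S = {k \<in> \<int>. - (M / r) \<le> k \<and> k \<le> M / r}"
  have "A \<subseteq> (\<lambda>f. r *\<^sub>R vec_lambda f) ` (UNIV \<rightarrow>\<^sub>E S)"
  proof
    fix x
    assume x: "x \<in> A"
    then obtain z where z: "x = r *\<^sub>R z" "\<And>i. z $ i \<in> \<int>"
      using A(1) unfolding grid_def by auto
    have "\<bar>r * z $ i\<bar> \<le> M" for i
      using component_le_infnorm_cart[of x i] A(2)[OF x] z(1) by simp
    then have "\<bar>z $ i\<bar> \<le> M / r" for i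
      using r by (simp add: abs_mult pos_le_divide_eq mult.commute)
    then have "- (M / r) \<le> z $ i \<and> z $ i \<le> M / r" for i
      by (metis abs_le_iff minus_le_iff)
    then have "vec_nth z \<in> UNIV \<rightarrow>\<^sub>E S"
      using z(2) by (auto simp: S_def)
    then show "x \<in> (\<lambda>f. r *\<^sub>R vec_lambda f) ` (UNIV \<rightarrow>\<^sub>E S)"
      using z(1) by (auto intro!: image_eqI[of _ _ "vec_nth z"])
  qed
  moreover have "finite (UNIV \<rightarrow>\<^sub>E S :: ('n \<Rightarrow> real) set)"
    unfolding S_def by (intro finite_PiE finite_int_segment) auto
  ultimately show ?thesis
    using finite_subset by blast
qed

lemma finite_grid_proj:
  fixes A :: "(real ^ 'n) set"
  assumes r: "0 < r" and A: "bounded A"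
  shows "finite (grid_proj r A)"
proof -
  obtain M where M: "norm a \<le> M" if "a \<in> A" for a
    using A unfolding bounded_iff by auto
  have "infnorm x \<le> M + r / 2" if x: "x \<in> grid_proj r A" for x
  proof -
    obtain a c where "x = a + c" "a \<in> A" "infnorm c \<le> r / 2"
      using x unfolding grid_proj_def max_ball_def by auto
    then show ?thesis
      using infnorm_triangle[of a c] infnorm_le_norm[of a] M[of a] by simp
  qed
  then show ?thesis
    using r by (intro finite_grid_bounded[of r _ "M + r / 2"]) (auto simp: grid_proj_def)
qed

lemma grid_proj_nonempty:
  fixes A :: "(real ^ 'n) set"
  assumes r: "0 < r" and A: "A \<noteq> {}"
  shows "grid_proj r A \<noteq> {}"
proof -
  obtain a where a: "a \<in> A" using A by auto
  \<comment> \<open>Rounding each coordinate to the nearest multiple of \<open>r\<close> moves the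
    point by at most \<open>r / 2\<close>, exactly the radius in \<open>grid_proj\<close>.\<close>
  define z :: "real ^ 'n" where "z = (\<chi> i. of_int (round (a $ i / r)))"
  have "\<bar>(r *\<^sub>R z - a) $ i\<bar> \<le> r / 2" for i
  proof -
    have "(r *\<^sub>R z - a) $ i = r * (of_int (round (a $ i / r)) - a $ i / r)"
      using r by (simp add: z_def algebra_simps)
    then have "\<bar>(r *\<^sub>R z - a) $ i\<bar> = r * \<bar>of_int (round (a $ i / r)) - a $ i / r\<bar>"
      using r by (simp only: abs_mult abs_of_pos)
    also have "\<dots> \<le> r * (1 / 2)"
      using r of_int_round_abs_le[of "a $ i / r"] by (intro mult_left_mono) auto
    finally show ?thesis by simp
  qed
  then have "infnorm (r *\<^sub>R z - a) \<le> r / 2"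
    unfolding infnorm_cart by (intro cSup_least) auto
  then have "r *\<^sub>R z - a \<in> max_ball 0 (r / 2)"
    by (simp add: max_ball_def)
  moreover have "r *\<^sub>R z = a + (r *\<^sub>R z - a)"
    by simp
  moreover have "r *\<^sub>R z \<in> grid r"
    by (auto simp: grid_def z_def)
  ultimately show ?thesis
    using a unfolding grid_proj_def by blast
qed

lemma discrete_step_finite_nonempty:
  fixes F :: "real ^ 'n \<Rightarrow> (real ^ 'n) set"
  assumes "0 < r" "compact (F x)" "F x \<noteq> {}"
  shows "finite (grid_proj r ((\<lambda>f. x + h *\<^sub>R f) ` F x))" "grid_proj r ((\<lambda>f. x + h *\<^sub>R f) ` F x) \<noteq> {}"
proof -
  have "compact ((\<lambda>f. x + h *\<^sub>R f) ` F x)"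
    using assms by (intro compact_continuous_image continuous_intros)
  then show "finite (grid_proj r ((\<lambda>f. x + h *\<^sub>R f) ` F x))"
    using assms by (intro finite_grid_proj compact_imp_bounded)
  show "grid_proj r ((\<lambda>f. x + h *\<^sub>R f) ` F x) \<noteq> {}"
    using assms by (intro grid_proj_nonempty) auto
qed

text \<open>Finiteness is proved along with nonemptiness because \<open>card\<close> is 0 on
  infinite sets, which would make the estimated volumes vanish.\<close>

lemma discrete_reach_finite_nonempty:
  fixes F :: "real ^ 'n \<Rightarrow> (real ^ 'n) set"
  assumes D: "is_discretization T D" and X0: "compact X0" "X0 \<noteq> {}"
    and F: "\<And>x. compact (F x)" "\<And>x. F x \<noteq> {}" and j: "j \<le> size_of D"
  shows "finite (discrete_reach X0 F D j) \<and> discrete_reach X0 F D j \<noteq> {}"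
  using j
proof (induction j)
  case 0
  have "0 < mesh_of D 0"
    using D unfolding is_discretization_iff by auto
  then show ?case
    using X0 by (simp add: finite_grid_proj grid_proj_nonempty compact_imp_bounded)
next
  case (Suc j)
  then have "0 < mesh_of D (Suc j)"
    using D unfolding is_discretization_iff by auto
  note step = discrete_step_finite_nonempty[where F = F, OF this F]
  show ?case
    using Suc step by auto
qed

lemma reach_volume_pos:
  fixes F :: "real ^ 'n \<Rightarrow> (real ^ 'n) set"
  assumes D: "is_discretization T D" and X0: "compact X0" "X0 \<noteq> {}"
    and F: "\<And>x. compact (F x)" "\<And>x. F x \<noteq> {}" and j: "j \<le> size_of D"
  shows "0 < reach_volume dR X0 F D j"
proof -
  have "0 < mesh_of D j"
    using D j unfolding is_discretization_iff by auto
  then show ?thesis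
    using discrete_reach_finite_nonempty[OF assms] by (simp add: reach_volume_def card_gt_0_iff)
qed

lemma field_volume_pos:
  fixes F :: "real ^ 'n \<Rightarrow> (real ^ 'n) set"
  assumes D: "is_discretization T D" and X0: "compact X0" "X0 \<noteq> {}"
    and F: "\<And>x. compact (F x)" "\<And>x. F x \<noteq> {}"
  shows "0 < field_volume dF X0 F D j"
proof -
  \<comment> \<open>The index actually evaluated: from the last node on, the value of the last step
    is repeated, so a next step always exists.\<close>
  define i where "i = (if j < size_of D then j else size_of D - 1)"
  let ?R = "discrete_reach X0 F D i"
  let ?N = "\<lambda>x. real (card (grid_proj (mesh_of D (Suc i)) ((\<lambda>f. x + step_of D (Suc i) *\<^sub>R f) ` F x)))"
  have i: "i < size_of D"
    using D unfolding i_def is_discretization_def by auto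
  then have pos: "0 < mesh_of D (Suc i)" "0 < step_of D (Suc i)"
    using D unfolding is_discretization_iff by auto
  have R: "finite ?R" "?R \<noteq> {}"
    using discrete_reach_finite_nonempty[OF D X0 F, of i] i by auto
  have "0 < ?N x" for x
    using discrete_step_finite_nonempty[where F = F, OF pos(1) F] by (simp add: card_gt_0_iff)
  then have "0 < (\<Sum>x\<in>?R. ?N x)"
    using R by (intro sum_pos) auto
  moreover have "0 < real (card ?R)"
    using R by (simp add: card_gt_0_iff)
  moreover have "0 < (mesh_of D (Suc i) / step_of D (Suc i)) powr dF"
    using pos by simp
  ultimately show ?thesis
    unfolding field_volume_def Let_def i_def[symmetric]
    by (intro mult_pos_pos divide_pos_pos) auto
qed

text \<open>On each subinterval the interpolant is a convex combination of two of the data.\<close>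

lemma interpolant_between:
  assumes D: "is_discretization T D" and s: "s \<in> {0..T}"
    and v: "\<And>j. j \<le> size_of D \<Longrightarrow> a \<le> v j \<and> v j \<le> c"
  shows "a \<le> interpolant D v s \<and> interpolant D v s \<le> c"
proof -
  let ?P = "\<lambda>j. s \<le> time_of D (Suc j)" and ?t = "time_of D"
  define j where "j = (LEAST j. ?P j)"
  define \<theta> where "\<theta> = (s - ?t j) / (?t (Suc j) - ?t j)"
  have n: "1 \<le> size_of D" and t: "?t 0 = 0" "?t (size_of D) = T"
    using D unfolding is_discretization_iff by auto
  have last: "?P (size_of D - 1)"
    using n t s by simp
  then have Pj: "?P j"
    unfolding j_def by (rule LeastI)
  have "j \<le> size_of D - 1"
    unfolding j_def using last by (rule Least_le)
  then have j: "j < size_of D"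
    using n by simp
  \<comment> \<open>Minimality of \<open>j\<close> puts \<open>s\<close> beyond the preceding
    interval; for \<open>j = 0\<close> the left end is time 0.\<close>
  have "?t j \<le> s"
  proof (cases j)
    case 0
    then show ?thesis using t s by simp
  next
    case (Suc i)
    then have "\<not> ?P i"
      unfolding j_def by (metis not_less_Least lessI)
    then show ?thesis using Suc by simp
  qed
  moreover have "?t j < ?t (Suc j)"
    using D j unfolding is_discretization_iff by auto
  ultimately have \<theta>: "0 \<le> \<theta>" "\<theta> \<le> 1"
    using Pj by (auto simp: \<theta>_def)
  have eq: "interpolant D v s = (1 - \<theta>) * v j + \<theta> * v (Suc j)"
    unfolding interpolant_def Let_def j_def[symmetric] \<theta>_def[symmetric] by (simp add: algebra_simps)
  have vj: "a \<le> v j" "v j \<le> c" "a \<le> v (Suc j)" "v (Suc j) \<le> c"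
    using v[of j] v[of "Suc j"] j by auto
  have "(1 - \<theta>) * a + \<theta> * a \<le> interpolant D v s"
    unfolding eq using vj \<theta> by (intro add_mono mult_left_mono) auto
  moreover have "interpolant D v s \<le> (1 - \<theta>) * c + \<theta> * c"
    unfolding eq using vj \<theta> by (intro add_mono mult_left_mono) auto
  ultimately show ?thesis
    by (simp add: algebra_simps)
qed

section \<open>Termination of the algorithm\<close>

definition positive_bounds :: "real \<Rightarrow> (real \<Rightarrow> real) \<Rightarrow> bool" where
  "positive_bounds T v \<longleftrightarrow> (\<exists>b B. 0 < b \<and> (\<forall>s\<in>{0..T}. b \<le> v s \<and> v s \<le> B))"

lemma positive_bounds_interpolant:
  assumes D: "is_discretization T D" and v: "\<And>j. j \<le> size_of D \<Longrightarrow> 0 < v j"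
  shows "positive_bounds T (interpolant D v)"
proof -
  let ?a = "Min (v ` {0..size_of D})" and ?c = "Max (v ` {0..size_of D})"
  have "0 < ?a"
    using v by (subst Min_gr_iff) auto
  moreover have "?a \<le> interpolant D v s \<and> interpolant D v s \<le> ?c" if "s \<in> {0..T}" for s
    using D that by (rule interpolant_between) auto
  ultimately show ?thesis
    unfolding positive_bounds_def by blast
qed

lemma positive_bounds_mult:
  assumes "positive_bounds T v" "positive_bounds T w"
  shows "positive_bounds T (\<lambda>s. v s * w s)"
proof -
  obtain a A b B where "0 < a" "0 < b" and bounds: "\<forall>s\<in>{0..T}. a \<le> v s \<and> v s \<le> A"
      "\<forall>s\<in>{0..T}. b \<le> w s \<and> w s \<le> B"
    using assms unfolding positive_bounds_def by auto
  moreover have "a * b \<le> v s * w s \<and> v s * w s \<le> A * B" if "s \<in> {0..T}" for s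
    using that bounds \<open>0 < a\<close> \<open>0 < b\<close> by (smt (verit) mult_mono)
  ultimately show ?thesis
    unfolding positive_bounds_def by (metis mult_pos_pos)
qed

text \<open>The mesh bounds are the values of the initial discretization. At level 0 the estimators
  are still undefined, hence the guard; the last conjunct is the accuracy claimed on return.\<close>

definition loop_invariant :: "real \<Rightarrow> real \<Rightarrow> real \<Rightarrow> nat \<Rightarrow> (nat \<Rightarrow> real) \<Rightarrow> state \<Rightarrow> bool" where
  "loop_invariant L P T lmax \<epsilon> s \<longleftrightarrow>
     is_discretization T (disc s) \<and>
     mesh_bounded (2 * L * P * T\<^sup>2) (T / (2 * L * P * T\<^sup>2)) (disc s) \<and>
     level s \<le> Suc lmax \<and>
     (1 \<le> level s \<longrightarrow> positive_bounds T (\<lambda>x. vR s x * vF s x)) \<and>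
     (lmax < level s \<longrightarrow> err L P T (disc s) \<le> \<epsilon> lmax)"

lemma loop_invariant_initial:
  assumes "0 < T" "0 < L" "0 < P"
  shows "loop_invariant L P T lmax \<epsilon> (initial_state L P T)"
proof -
  have "is_discretization T (disc (initial_state L P T))"
    using assms by (simp add: initial_state_def is_discretization_iff)
  moreover have "mesh_bounded (2 * L * P * T\<^sup>2) (T / (2 * L * P * T\<^sup>2)) (disc (initial_state L P T))"
    by (simp add: initial_state_def mesh_bounded_def)
  ultimately show ?thesis
    by (simp add: loop_invariant_def) (simp add: initial_state_def)
qed

lemma loop_invariant_pass:
  fixes F :: "real ^ 'n \<Rightarrow> (real ^ 'n) set"
  assumes pass: "loop_pass L P T X0 F dR dF lmax \<epsilon> s s'" and inv: "loop_invariant L P T lmax \<epsilon> s"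
    and X0: "compact X0" "X0 \<noteq> {}" and F: "\<And>x. compact (F x)" "\<And>x. F x \<noteq> {}"
    and lmax: "1 \<le> lmax"
  shows "loop_invariant L P T lmax \<epsilon> s'"
  using pass
proof cases
  case estimate
  have D: "is_discretization T (disc s)"
    using inv by (simp add: loop_invariant_def)
  have "positive_bounds T (interpolant (disc s) (reach_volume dR X0 F (disc s)))"
    by (intro positive_bounds_interpolant[OF D] reach_volume_pos[OF D X0 F])
  moreover have "positive_bounds T (interpolant (disc s) (field_volume dF X0 F (disc s)))"
    by (intro positive_bounds_interpolant[OF D] field_volume_pos[OF D X0 F])
  \<comment> \<open>The level can exceed \<open>lmax\<close> only through a pass tested against the
    last threshold; by \<open>1 <= lmax\<close> this is not the untested first pass.\<close>
  moreover have "err L P T (disc s) \<le> \<epsilon> lmax" if "lmax < Suc (level s)"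
  proof -
    have "level s = lmax"
      using that estimate by simp
    then show ?thesis
      using estimate lmax by auto
  qed
  ultimately show ?thesis
    using inv estimate unfolding loop_invariant_def by (auto intro: positive_bounds_mult)
next
  case (refine k)
  then have "k \<le> size_of (disc s)"
    by (simp add: is_arg_max_def)
  then show ?thesis
    using inv refine is_discretization_refine mesh_bounded_refine unfolding loop_invariant_def by auto
qed

section \<open>Progress and exclusion of infinite runs\<close>

text \<open>The quotients have a maximizer because the index set is finite and nonempty. So a run
  stops only after leaving the loop.\<close>

lemma loop_pass_possible:
  assumes "level s \<le> lmax"
  shows "\<exists>s'. loop_pass L P T X0 F dR dF lmax \<epsilon> s s'"
proof (cases "level s = 0 \<or> err L P T (disc s) \<le> \<epsilon> (level s)")
  case True
  then show ?thesis
    using loop_pass.estimate[OF assms] by blast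
next
  case False
  let ?f = "\<lambda>j. - delta_err L P T (disc s) j / delta_cost dR dF (vR s) (vF s) (disc s) j"
  let ?J = "{0..size_of (disc s)}"
  have "Max (?f ` ?J) \<in> ?f ` ?J"
    by (intro Max_in) auto
  then obtain k where "k \<in> ?J" "?f k = Max (?f ` ?J)"
    by (auto simp only: image_iff)
  then have "is_arg_max ?f (\<lambda>j. j \<in> ?J) k"
    by (simp add: is_arg_max_linorder)
  then show ?thesis
    using loop_pass.refine[where s = s and L = L and P = P and T = T and \<epsilon> = \<epsilon> and lmax = lmax, OF assms False] by blast
qed

lemma level_eventually_constant:
  fixes l :: "nat \<Rightarrow> nat"
  assumes "\<And>i. l i \<le> l (Suc i)" "\<And>i. l i \<le> M"
  obtains N where "\<And>i. N \<le> i \<Longrightarrow> l i = l N"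
proof -
  have mono: "l i \<le> l j" if "i \<le> j" for i j
    using lift_Suc_mono_le[of l i j] assms(1) that by simp
  have "finite (range l)"
    by (rule finite_subset[of _ "{..M}"]) (use assms(2) in auto)
  then have "Max (range l) \<in> range l"
    by (intro Max_in) auto
  then obtain N where N: "l N = Max (range l)"
    by auto
  have "l i = l N" if "N \<le> i" for i
    using mono[OF that] N \<open>finite (range l)\<close> by (metis Max_ge antisym rangeI)
  then show ?thesis
    using that by blast
qed

text \<open>A constant level excludes estimation passes, so the estimators stay those of
  \<open>s 0\<close> and the run is a greedy refinement against one threshold.\<close>

lemma no_infinite_refinement:
  fixes F :: "real ^ 'n \<Rightarrow> (real ^ 'n) set"
  assumes pos: "0 < T" "0 < L" "0 < P" "0 < dR" "0 \<le> dF"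
    and inv: "loop_invariant L P T lmax \<epsilon> (s 0)" and level: "1 \<le> level (s 0)"
    and pass: "\<And>i. loop_pass L P T X0 F dR dF lmax \<epsilon> (s i) (s (Suc i))"
    and const: "\<And>i. level (s i) = level (s 0)"
    and \<epsilon>: "0 < \<epsilon> (level (s 0))"
  shows False
proof -
  let ?gain = "\<lambda>D j. - delta_err L P T D j / delta_cost dR dF (vR (s 0)) (vF (s 0)) D j"
  have "vR (s (Suc i)) = vR (s i) \<and> vF (s (Suc i)) = vF (s i) \<and>
      \<epsilon> (level (s 0)) < err L P T (disc (s i)) \<and>
      (\<exists>k. is_arg_max (\<lambda>j. - delta_err L P T (disc (s i)) j /
              delta_cost dR dF (vR (s i)) (vF (s i)) (disc (s i)) j)
            (\<lambda>j. j \<in> {0..size_of (disc (s i))}) k \<and>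
         disc (s (Suc i)) = refine (disc (s i)) k)" for i
    using pass[of i]
  proof cases
    case estimate
    then have "level (s (Suc i)) = Suc (level (s i))"
      by simp
    then show ?thesis
      using const[of i] const[of "Suc i"] by simp
  next
    case (refine k)
    then show ?thesis
      using const[of i] by auto
  qed
  note step = this
  have v: "vR (s i) = vR (s 0) \<and> vF (s i) = vF (s 0)" for i
    by (induction i) (use step in auto)
  obtain b B where b: "0 < b" "\<forall>x\<in>{0..T}. b \<le> vR (s 0) x * vF (s 0) x \<and> vR (s 0) x * vF (s 0) x \<le> B"
    using inv level unfolding loop_invariant_def positive_bounds_def by auto
  interpret refinement_potential L P T dR dF "2 * L * P * T\<^sup>2" "T / (2 * L * P * T\<^sup>2)" b B
      "vR (s 0)" "vF (s 0)"
    using pos b by unfold_locales auto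
  show False
  proof (rule greedy_refinement_terminates[of "\<lambda>i. disc (s i)"])
    show "admissible (disc (s 0))"
      using inv by (simp add: loop_invariant_def admissible_def)
    show "0 < \<epsilon> (level (s 0))"
      by (fact \<epsilon>)
    show "\<epsilon> (level (s 0)) \<le> err L P T (disc (s i))" for i
      using step[of i] by simp
    show "\<exists>k. is_arg_max (?gain (disc (s i))) (\<lambda>j. j \<in> {0..size_of (disc (s i))}) k \<and>
        disc (s (Suc i)) = refine (disc (s i)) k" for i
      using step[of i] v[of i] by simp
  qed
qed

text \<open>Serves the second alternative of \<open>quotients_defined\<close>: every test succeeds,
  so every pass estimates and the level counts the passes, which is impossible beyond
  \<open>lmax\<close>.\<close>

lemma no_refinement_if_initially_accurate:
  assumes start: "s 0 = initial_state L P T"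
    and small: "\<And>l. 1 \<le> l \<Longrightarrow> l \<le> lmax \<Longrightarrow> err L P T (disc (initial_state L P T)) \<le> \<epsilon> l"
    and pass: "\<And>i. loop_pass L P T X0 F dR dF lmax \<epsilon> (s i) (s (Suc i))"
  shows False
proof -
  have "disc (s i) = disc (initial_state L P T) \<and> level (s i) = i" for i
  proof (induction i)
    case 0
    then show ?case by (simp add: start initial_state_def)
  next
    case (Suc i)
    show ?case
      using pass[of i]
    proof cases
      case estimate
      then show ?thesis using Suc by simp
    next
      case (refine k)
      then show ?thesis using Suc small[of i] by simp
    qed
  qed
  moreover have "level (s (Suc lmax)) \<le> lmax"
    using pass[of "Suc lmax"] by cases auto
  ultimately show False
    by simp
qed

text \<open>As any maximizer may be chosen, finite return is expressed by the absence of infinite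
  runs together with the correctness of every state in which a run stops.\<close>

theorem theorem4p8:
  fixes T L P dR dF :: real
    and X0 :: "(real ^ 'n) set"
    and F :: "real ^ 'n \<Rightarrow> (real ^ 'n) set"
    and dm :: "(real ^ 'n) set \<Rightarrow> ennreal"
    and lmax :: nat
    and \<epsilon> :: "nat \<Rightarrow> real"
  assumes "0 < T" and "0 < L" and "0 < P"
    and "compact X0" and "X0 \<noteq> {}"
    and "\<And>x. compact (F x)" and "\<And>x. convex (F x)" and "\<And>x. F x \<noteq> {}"
    and "\<And>x y. hausdorff_dist (F x) (F y) \<le> L * infnorm (x - y)"
    and "\<And>x f. f \<in> F x \<Longrightarrow> infnorm f \<le> P"
    and "set_dimension dm"
    and "dR = reach_dim dm T X0 F" and "dF = field_dim dm T X0 F"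
    and "1 \<le> lmax"
    and "\<And>l. 1 \<le> l \<Longrightarrow> l < lmax \<Longrightarrow> \<epsilon> (Suc l) < \<epsilon> l" and "0 < \<epsilon> lmax"
    and quotients_defined: "0 < dR \<or> err L P T (disc (initial_state L P T)) \<le> \<epsilon> lmax"
  shows "(\<nexists>s. s 0 = initial_state L P T \<and>
              (\<forall>i. loop_pass L P T X0 F dR dF lmax \<epsilon> (s i) (s (Suc i)))) \<and>
         (\<forall>s. (loop_pass L P T X0 F dR dF lmax \<epsilon>)\<^sup>*\<^sup>* (initial_state L P T) s \<and>
              (\<nexists>s'. loop_pass L P T X0 F dR dF lmax \<epsilon> s s') \<longrightarrow>
              lmax < level s \<and> is_discretization T (disc s) \<and> err L P T (disc s) \<le> \<epsilon> lmax)"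
proof (intro conjI allI impI)
  \<comment> \<open>Downward induction from \<open>lmax\<close>; positivity of the last threshold
    thereby passes to all of them.\<close>
  have thresholds: "\<epsilon> lmax \<le> \<epsilon> l" if "1 \<le> l" "l \<le> lmax" for l
    using that(2,1)
  proof (induction l rule: inc_induct)
    case (step l)
    then show ?case using assms(15)[of l] by force
  qed simp
  let ?pass = "loop_pass L P T X0 F dR dF lmax \<epsilon>"
  have inv_pass: "loop_invariant L P T lmax \<epsilon> s'" if "?pass s s'" "loop_invariant L P T lmax \<epsilon> s" for s s'
    by (rule loop_invariant_pass[OF that assms(4,5) assms(6,8) assms(14)])
  note inv0 = loop_invariant_initial[OF assms(1-3)]
  show "\<nexists>s. s 0 = initial_state L P T \<and> (\<forall>i. ?pass (s i) (s (Suc i)))"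
  proof
    assume "\<exists>s. s 0 = initial_state L P T \<and> (\<forall>i. ?pass (s i) (s (Suc i)))"
    then obtain s where s0: "s 0 = initial_state L P T" and pass: "\<And>i. ?pass (s i) (s (Suc i))"
      by auto
    have inv: "loop_invariant L P T lmax \<epsilon> (s i)" for i
    proof (induction i)
      case 0
      show ?case using inv0 by (simp add: s0)
    next
      case (Suc i)
      then show ?case using inv_pass[OF pass] by blast
    qed
    have running: "level (s i) \<le> lmax" for i
      using pass[of i] by cases auto
    have level_mono: "level (s i) \<le> level (s (Suc i))" for i
      using pass[of i] by cases auto
    obtain N where N: "\<And>i. N \<le> i \<Longrightarrow> level (s i) = level (s N)"
      using level_eventually_constant[of "\<lambda>i. level (s i)", OF level_mono running] by blast
    \<comment> \<open>At level 0 the pass is forced to estimate, which would raise the level after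
      \<open>N\<close>.\<close>
    have "level (s N) \<noteq> 0"
    proof
      assume "level (s N) = 0"
      have "level (s (Suc N)) = 1"
        using pass[of N] \<open>level (s N) = 0\<close> by cases auto
      then show False
        using N[of "Suc N"] \<open>level (s N) = 0\<close> by simp
    qed
    then have level: "1 \<le> level (s N)"
      by simp
    show False
      using quotients_defined
    proof
      assume "0 < dR"
      have "0 \<le> dF"
        by (simp add: assms(13) field_dim_def)
      show False
      \<comment> \<open>Applied to the tail of the run from \<open>N\<close> on, where the level is
        constant.\<close>
      proof (rule no_infinite_refinement[OF assms(1-3) \<open>0 < dR\<close> \<open>0 \<le> dF\<close>])
        show "?pass (s (N + i)) (s (N + Suc i))" for i
          using pass[of "N + i"] by simp
        show "loop_invariant L P T lmax \<epsilon> (s (N + 0))" "1 \<le> level (s (N + 0))"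
          using inv level by simp_all
        show "level (s (N + i)) = level (s (N + 0))" for i
          using N[of "N + i"] by simp
        show "0 < \<epsilon> (level (s (N + 0)))"
          using thresholds[OF level running] assms(16) by simp
      qed
    next
      assume "err L P T (disc (initial_state L P T)) \<le> \<epsilon> lmax"
      then show False
        using no_refinement_if_initially_accurate[OF s0 _ pass] thresholds by force
    qed
  qed
  fix s
  assume s: "?pass\<^sup>*\<^sup>* (initial_state L P T) s \<and> (\<nexists>s'. ?pass s s')"
  then have "?pass\<^sup>*\<^sup>* (initial_state L P T) s"
    by simp
  then have inv: "loop_invariant L P T lmax \<epsilon> s"
    by (induction rule: rtranclp_induct) (use inv0 inv_pass in blast)+
  show level: "lmax < level s"
    using s loop_pass_possible[of s lmax] by (meson not_le)
  show "is_discretization T (disc s)" "err L P T (disc s) \<le> \<epsilon> lmax"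
    using inv level by (auto simp: loop_invariant_def)
qed

end
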